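(* Let $\Lambda$ be an AR language with directive word $D=x_0x_1x_2\cdots$, let $p\ge0$, $D_p=x_0\cdots x_{p-1}$, let $z\in\{a,b,c\}$, and let $Z_p$ be $A_p$, $B_p$ or $C_p$ according to whether $z=a$, $b$ or $c$. Then $Z_p$ clusters if and only if there exists a letter $z'\in\{a,b,c\}$ such that, writing $\{z',u,u'\}=\{a,b,c\}$, in the word $D_pz$ neither the letters $z',u,u'$ (in that order) nor the letters $z',u',u$ (in that order) occur at any increasing sequence of indices. Moreover, in the cases where $Z_p$ clusters, it clusters perfectly for any order on $\{a,b,c\}$ for which the middle letter of $\{a,b,c\}$ is a letter $z'$ such that, writing $\{z',u,u'\}=\{a,b,c\}$, in the word $D_pz$ neither the letters $z',u,u'$ (in that order) nor the letters $z',u',u$ (in that order) occur at any increasing sequence of indices, and it does not cluster for any other order, whatever the permutation.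
   Context: AR (Arnoux-Rauzy) languages. The alphabet is $\{a,b,c\}$. Given an infinite sequence of rules $(x_k)_{k\ge0}$, $x_k\in\{a,b,c\}$, in which each of $a,b,c$ occurs infinitely often, define words by $A_0=a$, $B_0=b$, $C_0=c$ and: by rule $(a)$ at stage $k$ (i.e. $x_k=a$), $A_{k+1}=A_k$, $B_{k+1}=B_kA_k$, $C_{k+1}=C_kA_k$; by rule $(b)$, $A_{k+1}=A_kB_k$, $B_{k+1}=B_k$, $C_{k+1}=C_kB_k$; by rule $(c)$, $A_{k+1}=A_kC_k$, $B_{k+1}=B_kC_k$, $C_{k+1}=C_k$. The AR language $\Lambda$ is the set of all factors of the words $A_k,B_k,C_k$, $k\ge0$; its directive word is $D=x_0x_1x_2\cdots$. Clustering. For a total order on the alphabet, written $a_1<\dots<a_r$, the Burrows-Wheeler transform $B(w)$ of a word $w=w_1\cdots w_n$ is obtained by listing its $n$ cyclic conjugates $w_i\cdots w_nw_1\cdots w_{i-1}$ (with multiplicity) in nondecreasing lexicographical order and reading the sequence of their last letters. The word $w$ clusters for this order and a permutation $\pi\neq \mathrm{Id}$ of the alphabet if $B(w)=(\pi a_1)^{n_{\pi a_1}}\cdots(\pi a_r)^{n_{\pi a_r}}$, where $n_a\ge0$ is the number of occurrences of $a$ in $w$. It clusters perfectly for the order if it clusters for the symmetric permutation $\pi a_i=a_{r+1-i}$. "$w$ clusters" (with no order or permutation specified) means that $w$ clusters for some order on $\{a,b,c\}$ and some permutation $\pi\ne\mathrm{Id}$. *)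

theory Defs
  imports Main "HOL-Library.List_Lexorder" "HOL-Library.Sublist" "HOL-Library.Infinite_Set"
begin

text \<open>A total order \<open>a\<^sub>1 < \<dots> < a\<^sub>r\<close> on a finite alphabet is given by the
  list \<open>[a\<^sub>1, \<dots>, a\<^sub>r]\<close> of all letters in increasing order.\<close>

definition alphabet_order :: "'a list \<Rightarrow> bool" where
  "alphabet_order ord \<longleftrightarrow> distinct ord \<and> set ord = UNIV"

definition rank :: "'a list \<Rightarrow> 'a \<Rightarrow> nat" where
  "rank ord l = length (takeWhile (\<lambda>l'. l' \<noteq> l) ord)"

definition conjugates :: "'a list \<Rightarrow> 'a list list" where
  "conjugates w = map (\<lambda>i. rotate i w) [0..<length w]"

text \<open>Words are compared through their lists of ranks, for which \<open>List_Lexorder\<close> provides the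
  lexicographic order.  The ranks determine the word, so ties occur only between equal conjugates.\<close>

definition burrows_wheeler :: "'a list \<Rightarrow> 'a list \<Rightarrow> 'a list" where
  "burrows_wheeler ord w = map last (sort_key (map (rank ord)) (conjugates w))"

definition clusters_for :: "'a list \<Rightarrow> ('a \<Rightarrow> 'a) \<Rightarrow> 'a list \<Rightarrow> bool" where
  "clusters_for ord \<pi> w \<longleftrightarrow> bij \<pi> \<and> \<pi> \<noteq> id \<and>
     burrows_wheeler ord w = concat (map (\<lambda>l. replicate (count_list w (\<pi> l)) (\<pi> l)) ord)"

text \<open>The equation \<open>map \<pi> ord = rev ord\<close> says \<open>\<pi> a\<^sub>i = a\<^bsub>r+1-i\<^esub>\<close> for all \<open>i\<close>.\<close>

definition clusters_perfectly :: "'a list \<Rightarrow> 'a list \<Rightarrow> bool" where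
  "clusters_perfectly ord w \<longleftrightarrow> (\<exists>\<pi>. map \<pi> ord = rev ord \<and> clusters_for ord \<pi> w)"

definition clusters :: "'a list \<Rightarrow> bool" where
  "clusters w \<longleftrightarrow> (\<exists>ord \<pi>. alphabet_order ord \<and> clusters_for ord \<pi> w)"

datatype letter = La | Lb | Lc

text \<open>\<open>AR_word x k\<close> maps the letters \<open>a\<close>, \<open>b\<close>, \<open>c\<close> to the words \<open>A\<^sub>k\<close>, \<open>B\<^sub>k\<close>, \<open>C\<^sub>k\<close>.\<close>

primrec AR_word :: "(nat \<Rightarrow> letter) \<Rightarrow> nat \<Rightarrow> letter \<Rightarrow> letter list" where
  "AR_word x 0 z = [z]"
| "AR_word x (Suc k) z =
     (if z = x k then AR_word x k z else AR_word x k z @ AR_word x k (x k))"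

definition AR_language :: "letter list set \<Rightarrow> (nat \<Rightarrow> letter) \<Rightarrow> bool" where
  "AR_language \<Lambda> x \<longleftrightarrow>
     (\<forall>l. \<exists>\<^sub>\<infinity>k. x k = l) \<and> \<Lambda> = {w. \<exists>k z. sublist w (AR_word x k z)}"

text \<open>Here \<open>sublist\<close> is the factor relation (contiguous), whereas \<open>subseq\<close>
  is the scattered subword relation (occurrence at an increasing sequence of indices).\<close>

definition avoids_from :: "letter \<Rightarrow> letter list \<Rightarrow> bool" where
  "avoids_from z' v \<longleftrightarrow>
     (\<forall>u u'. {z', u, u'} = {La, Lb, Lc} \<longrightarrow> \<not> subseq [z', u, u'] v \<and> \<not> subseq [z', u', u] v)"

end

theory Submission
  imports Defs "HOL-Library.Multiset"
begin

text \<open>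
  Clustering is a monotonicity property: sorting the conjugates of \<open>w\<close> lexicographically also
  sorts their last letters, where letters at the end of a conjugate are compared through
  \<open>\<pi>\<inverse>\<close> (\<open>clusters_for_iff_last_monotone\<close>).  The word \<open>Z\<^sub>p\<close> arises from the letter \<open>z\<close> by the
  substitutions \<open>\<sigma>\<^sub>d\<close> with \<open>\<sigma>\<^sub>d(d) = d\<close> and \<open>\<sigma>\<^sub>d(e) = ed\<close> for \<open>e \<noteq> d\<close>, applied for the letters
  \<open>d\<close> of \<open>D\<^sub>p\<close> from the last to the first, so the question is how this monotonicity changes when
  \<open>w\<close> is replaced by \<open>\<sigma>\<^sub>d(w)\<close>.

  The conjugates of \<open>\<sigma>\<^sub>d(w)\<close> are of two kinds.  Every conjugate \<open>u\<close> of \<open>w\<close> gives the word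
  \<open>d\<sigma>\<^sub>d(u)\<close> without its final \<open>d\<close>; this map keeps the last letter and the lexicographic order, so
  that among these conjugates monotonicity holds exactly if it holds for \<open>w\<close>.  The remaining
  conjugates begin with a letter \<open>y \<noteq> d\<close> of \<open>w\<close> and end in \<open>d\<close>; their comparison with the first
  kind is decided by the first letters \<open>y\<close> and \<open>d\<close> (\<open>last_monotone_subst\<close>).  For three letters this
  comparison goes wrong, for whatever permutation, if \<open>d\<close> is the middle letter of the order and
  both other letters occur in \<open>w\<close>; otherwise it is correct for the symmetric permutation.  As
  \<open>w\<close> contains precisely the letters that occur after \<open>d\<close> in \<open>D\<^sub>pz\<close>, the bad situation is the
  occurrence of \<open>d\<close>, followed by the two other letters, as a scattered subword of \<open>D\<^sub>pz\<close>.
\<close>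

section \<open>Orders given by lists\<close>

lemma nth_rank:
  assumes "alphabet_order ord"
  shows "ord ! rank ord l = l" and "rank ord l < length ord"
proof -
  have "l \<in> set ord"
    using assms by (simp add: alphabet_order_def)
  then have "takeWhile (\<lambda>l'. l' \<noteq> l) ord \<noteq> ord"
    by (metis (mono_tags, lifting) takeWhile_eq_all_conv)
  then show less: "rank ord l < length ord"
    unfolding rank_def by (metis le_neq_implies_less length_takeWhile_le take_all_iff takeWhile_eq_take order_refl)
  show "ord ! rank ord l = l"
    using nth_length_takeWhile[of "\<lambda>l'. l' \<noteq> l" ord] less by (simp add: rank_def)
qed

lemma inj_rank: "alphabet_order ord \<Longrightarrow> inj (rank ord)"
  by (metis injI nth_rank(1))

lemma rank_nth:
  assumes "alphabet_order ord" "i < length ord"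
  shows "rank ord (ord ! i) = i"
  using assms nth_rank[OF assms(1), of "ord ! i"] by (simp add: alphabet_order_def nth_eq_iff_index_eq)

lemma map_rank: "alphabet_order ord \<Longrightarrow> map (rank ord) ord = [0..<length ord]"
  by (rule nth_equalityI) (simp_all add: rank_nth)

section \<open>Clustering as monotonicity of last letters\<close>

text \<open>Here \<open>r\<close> orders the letters in the lexicographic comparison, and \<open>k\<close> orders the last letters.\<close>

definition last_monotone :: "('a \<Rightarrow> nat) \<Rightarrow> ('a \<Rightarrow> nat) \<Rightarrow> 'a list \<Rightarrow> bool" where
  "last_monotone r k w \<longleftrightarrow>
     (\<forall>u\<in>set (conjugates w). \<forall>u'\<in>set (conjugates w).
        map r u < map r u' \<longrightarrow> k (last u) \<le> k (last u'))"

lemma set_conjugates: "w \<noteq> [] \<Longrightarrow> set (conjugates w) = range (\<lambda>n. rotate n w)"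
  unfolding conjugates_def
  by (auto simp: image_iff) (metis atLeastLessThan_iff le0 length_greater_0_conv mod_less_divisor rotate_conv_mod)

lemma mset_last_conjugates: "mset (map last (conjugates w)) = mset w"
proof (cases "w = []")
  case False
  have "map last (conjugates w) = last w # butlast w"
  proof (rule nth_equalityI)
    fix i assume "i < length (map last (conjugates w))"
    then have i: "i < length w"
      by (simp add: conjugates_def)
    show "map last (conjugates w) ! i = (last w # butlast w) ! i"
    proof (cases i)
      case 0
      then show ?thesis using i by (simp add: conjugates_def)
    next
      case (Suc j)
      have "last (rotate i w) = w ! ((i + (length w - 1)) mod length w)"
        using False by (simp add: last_conv_nth nth_rotate)
      also have "i + (length w - 1) = j + length w"
        using i Suc by simp
      also have "(j + length w) mod length w = j"
        using i Suc by simp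
      finally show ?thesis
        using i Suc by (simp add: conjugates_def nth_butlast)
    qed
  qed (use False in \<open>simp add: conjugates_def\<close>)
  moreover have "mset w = mset (butlast w @ [last w])"
    using False by simp
  ultimately show ?thesis by simp
qed (simp add: conjugates_def)

lemma sorted_last_iff_last_monotone:
  assumes "inj r"
  shows "sorted (map k (map last (sort_key (map r) (conjugates w)))) \<longleftrightarrow> last_monotone r k w"
proof -
  define cs where "cs = sort_key (map r) (conjugates w)"
  have set_cs: "set cs = set (conjugates w)"
    by (simp add: cs_def)
  have sorted_cs: "sorted (map (map r) cs)"
    by (simp add: cs_def)
  have "sorted (map k (map last cs)) \<longleftrightarrow> last_monotone r k w"
  proof
    assume *: "sorted (map k (map last cs))"
    show "last_monotone r k w"
      unfolding last_monotone_def set_cs[symmetric]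
    proof (intro ballI impI)
      fix u u' assume "u \<in> set cs" "u' \<in> set cs" and less: "map r u < map r u'"
      then obtain i j where ij: "i < length cs" "j < length cs" "u = cs ! i" "u' = cs ! j"
        by (metis in_set_conv_nth)
      have "i < j"
      proof (rule ccontr)
        assume "\<not> i < j"
        then have "map r u' \<le> map r u"
          using sorted_nth_mono[OF sorted_cs, of j i] ij by simp
        with less show False by simp
      qed
      then show "k (last u) \<le> k (last u')"
        using sorted_nth_mono[OF *, of i j] ij by simp
    qed
  next
    assume *: "last_monotone r k w"
    show "sorted (map k (map last cs))"
      unfolding sorted_iff_nth_mono
    proof (intro allI impI)
      fix i j assume "i \<le> j" "j < length (map k (map last cs))"
      then have ij: "i < length cs" "j < length cs" "map r (cs ! i) \<le> map r (cs ! j)"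
        using sorted_nth_mono[OF sorted_cs, of i j] by auto
      have "k (last (cs ! i)) \<le> k (last (cs ! j))"
      proof (cases "map r (cs ! i) = map r (cs ! j)")
        case True
        then show ?thesis using assms by (simp add: inj_map_eq_map)
      next
        case False
        then show ?thesis
          using * ij set_cs unfolding last_monotone_def by (metis nth_mem order_less_le)
      qed
      then show "map k (map last cs) ! i \<le> map k (map last cs) ! j"
        using ij by simp
    qed
  qed
  then show ?thesis by (simp add: cs_def)
qed

lemma sorted_concat_replicate:
  fixes f :: "'a \<Rightarrow> nat"
  assumes "sorted (map f xs)"
  shows "sorted (concat (map (\<lambda>l. replicate (c l) (f l)) xs))"
  using assms by (induction xs) (auto simp: sorted_append)

lemma mset_concat_replicate_count:
  assumes "distinct xs" "set w \<subseteq> set xs"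
  shows "mset (concat (map (\<lambda>l. replicate (count_list w l) l) xs)) = mset w"
proof (rule multiset_eqI)
  fix a
  have "count (mset (concat (map (\<lambda>l. replicate (count_list w l) l) xs))) a =
      (if a \<in> set xs then count_list w a else 0)"
    using assms(1) by (induction xs) auto
  then show "count (mset (concat (map (\<lambda>l. replicate (count_list w l) l) xs))) a = count (mset w) a"
    using assms(2) by (auto simp: count_mset count_list_0_iff)
qed

text \<open>The word prescribed for the transform is the only rearrangement of \<open>w\<close> that is sorted with
  respect to the rank of \<open>\<pi>\<inverse>\<close>, and the transform is always a rearrangement of \<open>w\<close>.\<close>

lemma clusters_for_iff_last_monotone:
  assumes ord: "alphabet_order ord"
  shows "clusters_for ord \<pi> w \<longleftrightarrow>
    bij \<pi> \<and> \<pi> \<noteq> id \<and> last_monotone (rank ord) (rank ord \<circ> inv \<pi>) w"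
proof (cases "bij \<pi>")
  case True
  define k where "k = rank ord \<circ> inv \<pi>"
  define bw where "bw = burrows_wheeler ord w"
  define target where "target = concat (map (\<lambda>l. replicate (count_list w (\<pi> l)) (\<pi> l)) ord)"
  have inj_k: "inj k"
    unfolding k_def by (intro inj_compose inj_rank ord bij_is_inj bij_imp_bij_inv True)
  have k_\<pi>: "k (\<pi> l) = rank ord l" for l
    using True by (simp add: k_def bij_is_inj)
  have "map k target = concat (map (\<lambda>l. replicate (count_list w (\<pi> l)) (rank ord l)) ord)"
    by (simp add: target_def map_concat comp_def k_\<pi>)
  then have sorted_target: "sorted (map k target)"
    using sorted_concat_replicate[of "rank ord" ord] map_rank[OF ord] by simp
  have "distinct (map \<pi> ord)" "set (map \<pi> ord) = UNIV"
    using True ord by (auto simp: alphabet_order_def distinct_map bij_is_surj bij_is_inj inj_on_subset)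
  then have "mset target = mset w"
    using mset_concat_replicate_count[of "map \<pi> ord" w] by (simp add: target_def comp_def)
  moreover have "mset bw = mset w"
    using mset_last_conjugates[of w] by (simp add: bw_def burrows_wheeler_def)
  ultimately have mset_eq: "mset (map k bw) = mset (map k target)"
    by simp
  have "bw = target \<longleftrightarrow> map k bw = map k target"
    using inj_k by (simp add: inj_map_eq_map)
  also have "\<dots> \<longleftrightarrow> sorted (map k bw)"
  proof
    assume "sorted (map k bw)"
    then show "map k bw = map k target"
      using properties_for_sort[OF mset_eq] sort_key_id_if_sorted[of "\<lambda>n. n" "map k target"] sorted_target
      by simp
  qed (use sorted_target in simp)
  also have "\<dots> \<longleftrightarrow> last_monotone (rank ord) k w"
    unfolding bw_def burrows_wheeler_def
    by (rule sorted_last_iff_last_monotone[OF inj_rank[OF ord]])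
  finally show ?thesis
    using True by (simp add: clusters_for_def bw_def target_def k_def)
qed (simp add: clusters_for_def)

section \<open>Conjugates under an Arnoux-Rauzy substitution\<close>

definition AR_subst :: "'a \<Rightarrow> 'a list \<Rightarrow> 'a list" where
  "AR_subst d w = concat (map (\<lambda>e. if e = d then [e] else [e, d]) w)"

lemma AR_subst_simps [simp]:
  "AR_subst d [] = []"
  "AR_subst d (e # w) = (if e = d then e # AR_subst d w else e # d # AR_subst d w)"
  "AR_subst d (v @ w) = AR_subst d v @ AR_subst d w"
  by (simp_all add: AR_subst_def)

lemma AR_subst_eq_Nil_iff [simp]: "AR_subst d w = [] \<longleftrightarrow> w = []"
  by (cases w) auto

lemma set_AR_subst: "w \<noteq> [] \<Longrightarrow> set (AR_subst d w) = insert d (set w)"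
proof (induction w)
  case (Cons e w)
  then show ?case by (cases "w = []") auto
qed simp

lemma last_AR_subst: "w \<noteq> [] \<Longrightarrow> last (AR_subst d w) = d"
  by (induction w) auto

lemma length_AR_subst_cong: "mset v = mset w \<Longrightarrow> length (AR_subst d v) = length (AR_subst d w)"
proof -
  have length: "length (AR_subst d w) = (\<Sum>e\<in>#mset w. if e = d then 1 else 2)" for w
    by (induction w) auto
  show "length (AR_subst d v) = length (AR_subst d w)" if "mset v = mset w"
    unfolding length that ..
qed

text \<open>The decomposition form of conjugacy, which is compatible with \<^term>\<open>AR_subst d\<close>.\<close>

lemma conjugates_eq_swaps:
  assumes "w \<noteq> []"
  shows "set (conjugates w) = {v @ u | u v. w = u @ v}"
proof -
  have "rotate n w \<in> {v @ u | u v. w = u @ v}" for n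
    unfolding rotate_drop_take by (metis (mono_tags, lifting) append_take_drop_id mem_Collect_eq)
  moreover have "v @ u \<in> range (\<lambda>n. rotate n (u @ v))" for u v :: "'a list"
    by (metis rangeI rotate_append)
  ultimately show ?thesis
    using assms by (auto simp: set_conjugates)
qed

lemma mset_conjugate: "u \<in> set (conjugates w) \<Longrightarrow> mset u = mset w"
  by (cases "w = []") (auto simp: conjugates_eq_swaps, simp add: conjugates_def)

lemma conjugates_trans:
  assumes "u \<in> set (conjugates v)" "v \<in> set (conjugates w)"
  shows "u \<in> set (conjugates w)"
proof -
  have "v \<noteq> []" "w \<noteq> []"
    using assms by (auto simp: conjugates_def)
  then show ?thesis
    using assms by (auto simp: set_conjugates rotate_rotate)
qed

lemma conjugate_append: "u @ v \<noteq> [] \<Longrightarrow> v @ u \<in> set (conjugates (u @ v))"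
  by (auto simp: conjugates_eq_swaps)

lemma ex_conjugate_hd:
  assumes "y \<in> set w"
  shows "\<exists>u\<in>set (conjugates w). hd u = y"
proof -
  obtain s t where "w = s @ y # t"
    using assms by (meson split_list)
  then show ?thesis
    using conjugate_append[of s "y # t"] by (metis Nil_is_append_conv append_Cons list.discI list.sel(1))
qed

lemma ex_conjugate_last:
  assumes "y \<in> set w"
  shows "\<exists>u\<in>set (conjugates w). last u = y"
proof -
  obtain s t where w: "w = (s @ [y]) @ t"
    using assms by (metis append.assoc append_Cons append_Nil split_list)
  show ?thesis
    using conjugate_append[of "s @ [y]" t] unfolding w by (intro bexI[of _ "t @ s @ [y]"]) auto
qed

text \<open>The conjugate of \<open>\<sigma>\<^sub>d(w)\<close> that corresponds to the conjugate \<open>u\<close> of \<open>w\<close>: the final letter \<open>d\<close>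
  of \<open>\<sigma>\<^sub>d(u)\<close> is moved to the front.\<close>

definition AR_shift :: "'a \<Rightarrow> 'a list \<Rightarrow> 'a list" where
  "AR_shift d u = butlast (d # AR_subst d u)"

lemma AR_shift_append: "u \<noteq> [] \<Longrightarrow> AR_shift d u @ [d] = d # AR_subst d u"
  unfolding AR_shift_def
  by (metis AR_subst_eq_Nil_iff append_butlast_last_id last.simps last_AR_subst list.discI)

lemma AR_shift_snoc:
  "AR_shift d (s @ [e]) = (if e = d then d # AR_subst d s else d # AR_subst d s @ [e])"
  by (auto simp: AR_shift_def butlast_append)

lemma last_AR_shift:
  assumes "u \<noteq> []"
  shows "last (AR_shift d u) = last u"
proof -
  obtain s e where "u = s @ [e]"
    using assms by (metis rev_exhaust)
  then show ?thesis
    using AR_shift_snoc[of d s e] by (cases "s = []") (auto simp: last_AR_subst)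
qed

lemma hd_AR_shift: "u \<noteq> [] \<Longrightarrow> AR_shift d u \<noteq> [] \<and> hd (AR_shift d u) = d"
  by (cases u rule: rev_cases) (auto simp: AR_shift_snoc)

lemma AR_subst_split:
  assumes "AR_subst d w = A @ B"
  shows "(\<exists>a b. w = a @ b \<and> A = AR_subst d a \<and> B = AR_subst d b) \<or>
    (\<exists>a e b. w = a @ e # b \<and> e \<noteq> d \<and> A = AR_subst d a @ [e] \<and> B = d # AR_subst d b)"
  using assms
proof (induction w arbitrary: A)
  case (Cons f w)
  let ?f = "if f = d then [f] else [f, d]"
  have eq: "?f @ AR_subst d w = A @ B"
    using Cons.prems by (auto split: if_splits)
  show ?case
  proof (cases "length ?f \<le> length A")
    case True
    then obtain A' where A: "A = ?f @ A'" "AR_subst d w = A' @ B"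
      using eq by (auto simp: append_eq_append_conv2)
    from Cons.IH[OF A(2)] show ?thesis
    proof (elim disjE exE conjE)
      fix a b assume "w = a @ b" "A' = AR_subst d a" "B = AR_subst d b"
      then have "f # w = (f # a) @ b \<and> A = AR_subst d (f # a) \<and> B = AR_subst d b"
        using A by auto
      then show ?thesis by blast
    next
      fix a e b assume "w = a @ e # b" "e \<noteq> d" "A' = AR_subst d a @ [e]" "B = d # AR_subst d b"
      then have "f # w = (f # a) @ e # b \<and> e \<noteq> d \<and> A = AR_subst d (f # a) @ [e] \<and> B = d # AR_subst d b"
        using A by auto
      then show ?thesis by blast
    qed
  next
    case False
    then consider "A = []" | "f \<noteq> d" "length A = 1"
      by (cases A) (auto simp: less_Suc_eq not_le split: if_splits)
    then show ?thesis
    proof cases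
      case 1
      then have "f # w = [] @ f # w \<and> A = AR_subst d [] \<and> B = AR_subst d (f # w)"
        using Cons.prems by simp
      then show ?thesis by blast
    next
      case 2
      then have "f # w = [] @ f # w \<and> f \<noteq> d \<and> A = AR_subst d [] @ [f] \<and> B = d # AR_subst d w"
        using eq by (cases A) auto
      then show ?thesis by blast
    qed
  qed
qed simp

lemma AR_subst_mem_conjugates:
  assumes "u \<in> set (conjugates w)"
  shows "AR_subst d u \<in> set (conjugates (AR_subst d w))"
proof -
  have "w \<noteq> []"
    using assms by (auto simp: conjugates_def)
  then obtain a b where "w = a @ b" "u = b @ a"
    using assms by (auto simp: conjugates_eq_swaps)
  then show ?thesis
    using \<open>w \<noteq> []\<close> conjugate_append[of "AR_subst d a" "AR_subst d b"] by simp
qed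

lemma AR_shift_mem_conjugates:
  assumes "u \<in> set (conjugates w)"
  shows "AR_shift d u \<in> set (conjugates (AR_subst d w))"
proof (rule conjugates_trans[OF _ AR_subst_mem_conjugates[OF assms]])
  have "u \<noteq> []"
    using assms by (auto simp: conjugates_def)
  then have "AR_subst d u = butlast (AR_subst d u) @ [d]"
    by (metis AR_subst_eq_Nil_iff append_butlast_last_id last_AR_subst)
  moreover have "AR_shift d u = [d] @ butlast (AR_subst d u)"
    using \<open>u \<noteq> []\<close> by (simp add: AR_shift_def)
  ultimately show "AR_shift d u \<in> set (conjugates (AR_subst d u))"
    using conjugate_append[of "butlast (AR_subst d u)" "[d]"] by (metis Nil_is_append_conv list.discI)
qed

text \<open>A conjugate of \<open>\<sigma>\<^sub>d(w)\<close> that starts inside the image \<open>ed\<close> of a letter is \<open>AR_shift\<close> of a conjugate of \<open>w\<close>.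
  One that starts at a boundary is \<open>\<sigma>\<^sub>d(u)\<close>, and if \<open>u = dt\<close> this is \<open>AR_shift\<close> of \<open>td\<close>.\<close>

lemma conjugates_AR_subst:
  assumes "w \<noteq> []"
  shows "set (conjugates (AR_subst d w)) =
    AR_shift d ` set (conjugates w) \<union> AR_subst d ` {u \<in> set (conjugates w). hd u \<noteq> d}"
    (is "?L = ?R")
proof
  show "?R \<subseteq> ?L"
    using AR_subst_mem_conjugates AR_shift_mem_conjugates by fast
  show "?L \<subseteq> ?R"
  proof
    fix c assume "c \<in> ?L"
    then obtain A B where c: "c = B @ A" "AR_subst d w = A @ B"
      using assms by (auto simp: conjugates_eq_swaps)
    from AR_subst_split[OF c(2)] show "c \<in> ?R"
    proof (elim disjE exE conjE)
      fix a b assume ab: "w = a @ b" "A = AR_subst d a" "B = AR_subst d b"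
      then have u: "b @ a \<in> set (conjugates w)"
        using assms by (simp add: conjugate_append)
      have c_eq: "c = AR_subst d (b @ a)"
        by (simp add: c ab)
      show ?thesis
      proof (cases "hd (b @ a) = d")
        case False
        then show ?thesis using u c_eq by blast
      next
        case True
        then obtain t where t: "b @ a = d # t"
          using assms ab by (metis append_is_Nil_conv list.collapse)
        have "t @ [d] \<in> set (conjugates w)"
          using conjugates_trans[OF _ u] conjugate_append[of "[d]" t] t by simp
        moreover have "c = AR_shift d (t @ [d])"
          using c_eq unfolding t by (simp add: AR_shift_snoc)
        ultimately show ?thesis by blast
      qed
    next
      fix a e b
      assume aeb: "w = a @ e # b" "e \<noteq> d" "A = AR_subst d a @ [e]" "B = d # AR_subst d b"
      then have "(b @ a) @ [e] \<in> set (conjugates w)"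
        using conjugate_append[of "a @ [e]" b] by simp
      moreover have "c = AR_shift d ((b @ a) @ [e])"
        using aeb unfolding AR_shift_snoc c by simp
      ultimately show ?thesis by blast
    qed
  qed
qed

text \<open>Substituted words agree up to the first difference of the original words and then show the
  differing letters themselves, since the image of a letter begins with that letter.\<close>

lemma AR_subst_less:
  fixes r :: "'a \<Rightarrow> nat"
  assumes "inj r" "map r u < map r u'" "length u = length u'"
  shows "map r (AR_subst d u) < map r (AR_subst d u')"
  using assms(2,3)
proof (induction u arbitrary: u')
  case (Cons e u)
  then obtain e' v where u': "u' = e' # v" "length u = length v"
    by (cases u') auto
  show ?case
  proof (cases "e = e'")
    case True
    then have "map r (AR_subst d u) < map r (AR_subst d v)"
      using Cons u' by auto
    then show ?thesis using True u' by auto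
  next
    case False
    then have "r e < r e'"
      using Cons.prems u' \<open>inj r\<close> by (auto simp: inj_eq)
    then show ?thesis using u' False by auto
  qed
qed simp

lemma snoc_less_snoc_iff:
  fixes a :: "'a :: linorder"
  assumes "length xs = length ys"
  shows "xs @ [a] < ys @ [a] \<longleftrightarrow> xs < ys"
  using assms by (induction xs ys rule: list_induct2) auto

text \<open>Appending \<open>d\<close> to \<open>AR_shift d u\<close> gives \<open>d\<sigma>\<^sub>d(u)\<close>.  As conjugates are rearrangements of one another,
  their shifts have equal length, and the appended letter does not affect the comparison.\<close>

lemma AR_shift_less:
  fixes r :: "'a \<Rightarrow> nat"
  assumes "inj r" "map r u < map r u'" "mset u = mset u'"
  shows "map r (AR_shift d u) < map r (AR_shift d u')"
proof -
  have nonempty: "u \<noteq> []" "u' \<noteq> []"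
    using assms(2,3) by auto
  have "map r (AR_subst d u) < map r (AR_subst d u')"
    using assms mset_eq_length by (intro AR_subst_less) auto
  then have "map r (AR_shift d u @ [d]) < map r (AR_shift d u' @ [d])"
    using nonempty by (simp add: AR_shift_append del: map_append)
  moreover have "length (AR_shift d u) = length (AR_shift d u')"
    using nonempty by (simp add: AR_shift_def length_AR_subst_cong[OF assms(3)])
  ultimately show ?thesis
    by (simp add: snoc_less_snoc_iff)
qed

lemma AR_shift_less_iff:
  fixes r :: "'a \<Rightarrow> nat"
  assumes "inj r" "mset u = mset u'"
  shows "map r (AR_shift d u) < map r (AR_shift d u') \<longleftrightarrow> map r u < map r u'"
proof -
  have "map r (AR_shift d u') < map r (AR_shift d u)" if "map r u' < map r u"
    using AR_shift_less[OF assms(1) that] assms(2) by metis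
  moreover have "u = u'" if "map r u = map r u'"
    using that assms(1) by (simp add: inj_map_eq_map)
  ultimately show ?thesis
    using AR_shift_less[OF assms(1) _ assms(2)] by (metis less_asym linorder_neqE less_irrefl)
qed

lemma map_less_by_hd:
  fixes r :: "'a \<Rightarrow> nat"
  assumes "u \<noteq> []" "v \<noteq> []" "r (hd u) \<noteq> r (hd v)"
  shows "map r u < map r v \<longleftrightarrow> r (hd u) < r (hd v)"
  using assms by (cases u; cases v) auto

text \<open>The extra condition for passing from \<open>w\<close> to \<open>\<sigma>\<^sub>d(w)\<close>: a conjugate that begins with \<open>y \<noteq> d\<close> and
  ends in \<open>d\<close> is compared with one that begins with \<open>d\<close> and ends in \<open>e\<close>.  Letters \<open>y\<close> and \<open>e\<close> of
  \<open>w\<close> are combined freely here.\<close>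

definition letter_monotone :: "('a \<Rightarrow> nat) \<Rightarrow> ('a \<Rightarrow> nat) \<Rightarrow> 'a \<Rightarrow> 'a set \<Rightarrow> bool" where
  "letter_monotone r k d S \<longleftrightarrow>
     (\<forall>y\<in>S. \<forall>e\<in>S. (r y < r d \<longrightarrow> k d \<le> k e) \<and> (r d < r y \<longrightarrow> k e \<le> k d))"

lemma last_monotone_subst:
  assumes "inj r" "w \<noteq> []"
  shows "last_monotone r k (AR_subst d w) \<longleftrightarrow> last_monotone r k w \<and> letter_monotone r k d (set w)"
proof -
  let ?C = "set (conjugates w)"
  let ?P = "\<lambda>c c'. map r c < map r c' \<longrightarrow> k (last c) \<le> k (last c')"
  let ?E = "{u \<in> ?C. hd u \<noteq> d}"
  have nonempty: "u \<noteq> []" if "u \<in> ?C" for u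
    using that by (auto simp: conjugates_def)
  have shift_shift: "?P (AR_shift d u) (AR_shift d u') \<longleftrightarrow> ?P u u'" if "u \<in> ?C" "u' \<in> ?C" for u u'
    using AR_shift_less_iff[OF assms(1), of u u' d] mset_conjugate[OF that(1)] mset_conjugate[OF that(2)]
      last_AR_shift[OF nonempty[OF that(1)], of d] last_AR_shift[OF nonempty[OF that(2)], of d] by metis
  have subst_subst: "?P (AR_subst d u) (AR_subst d u')" if "u \<in> ?E" "u' \<in> ?E" for u u'
    using that by (simp add: last_AR_subst nonempty)
  have subst_shift:
    "?P (AR_subst d u) (AR_shift d u') \<longleftrightarrow> (r (hd u) < r d \<longrightarrow> k d \<le> k (last u'))"
    "?P (AR_shift d u') (AR_subst d u) \<longleftrightarrow> (r d < r (hd u) \<longrightarrow> k (last u') \<le> k d)"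
    if "u \<in> ?E" "u' \<in> ?C" for u u'
  proof -
    have hd: "hd (AR_subst d u) = hd u" "AR_subst d u \<noteq> []"
      using that nonempty[of u] by (cases u; simp)+
    have ne: "r (hd u) \<noteq> r d"
      using that assms(1) by (auto simp: inj_eq)
    show "?P (AR_subst d u) (AR_shift d u') \<longleftrightarrow> (r (hd u) < r d \<longrightarrow> k d \<le> k (last u'))"
      "?P (AR_shift d u') (AR_subst d u) \<longleftrightarrow> (r d < r (hd u) \<longrightarrow> k (last u') \<le> k d)"
      using that hd ne hd_AR_shift[OF nonempty, of u' d]
      by (simp_all add: map_less_by_hd last_AR_subst last_AR_shift nonempty)
  qed
  have hd_last_in: "hd u \<in> set w" "last u \<in> set w" if "u \<in> ?C" for u
    using nonempty[OF that] mset_eq_setD[OF mset_conjugate[OF that]] hd_in_set last_in_set by blast+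
  have letters: "letter_monotone r k d (set w) \<longleftrightarrow>
      (\<forall>u\<in>?E. \<forall>u'\<in>?C. (r (hd u) < r d \<longrightarrow> k d \<le> k (last u')) \<and> (r d < r (hd u) \<longrightarrow> k (last u') \<le> k d))"
    (is "_ \<longleftrightarrow> ?all")
  proof
    assume "letter_monotone r k d (set w)"
    then show ?all
      unfolding letter_monotone_def using hd_last_in by blast
  next
    assume all: ?all
    show "letter_monotone r k d (set w)"
      unfolding letter_monotone_def
    proof (intro ballI)
      fix y e assume "y \<in> set w" "e \<in> set w"
      then obtain u u' where "u \<in> ?C" "hd u = y" "u' \<in> ?C" "last u' = e"
        using ex_conjugate_hd ex_conjugate_last by metis
      then show "(r y < r d \<longrightarrow> k d \<le> k e) \<and> (r d < r y \<longrightarrow> k e \<le> k d)"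
        using all by (cases "y = d") auto
    qed
  qed
  have "last_monotone r k (AR_subst d w) \<longleftrightarrow>
      (\<forall>u\<in>?C. \<forall>u'\<in>?C. ?P (AR_shift d u) (AR_shift d u')) \<and>
      (\<forall>u\<in>?E. \<forall>u'\<in>?E. ?P (AR_subst d u) (AR_subst d u')) \<and>
      (\<forall>u\<in>?E. \<forall>u'\<in>?C. ?P (AR_subst d u) (AR_shift d u') \<and> ?P (AR_shift d u') (AR_subst d u))"
    unfolding last_monotone_def conjugates_AR_subst[OF assms(2)] ball_Un ball_simps by blast
  also have "(\<forall>u\<in>?C. \<forall>u'\<in>?C. ?P (AR_shift d u) (AR_shift d u')) \<longleftrightarrow> last_monotone r k w"
    unfolding last_monotone_def using shift_shift by simp
  also have "(\<forall>u\<in>?E. \<forall>u'\<in>?C. ?P (AR_subst d u) (AR_shift d u') \<and> ?P (AR_shift d u') (AR_subst d u))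
      \<longleftrightarrow> letter_monotone r k d (set w)"
    unfolding letters using subst_shift by (intro ball_cong refl) blast
  finally show ?thesis
    using subst_subst by blast
qed

section \<open>Three letters\<close>

text \<open>The recursion for the AR words appends the rule \<open>x\<^sub>k\<close> at the end of the directive word; the
  induction along \<open>D\<^sub>p\<close> needs the first rule \<open>x\<^sub>0\<close>, which acts on the whole word as a substitution.\<close>

lemma AR_word_Suc_eq_subst: "AR_word x (Suc k) z = AR_subst (x 0) (AR_word (\<lambda>i. x (Suc i)) k z)"
proof (induction k arbitrary: z)
  case (Suc k)
  have "AR_word x (Suc (Suc k)) z = (if z = x (Suc k) then AR_word x (Suc k) z
      else AR_word x (Suc k) z @ AR_word x (Suc k) (x (Suc k)))"
    by (rule AR_word.simps)
  also have "\<dots> = AR_subst (x 0) (AR_word (\<lambda>i. x (Suc i)) (Suc k) z)"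
    unfolding Suc.IH by simp
  finally show ?case .
qed auto

lemma AR_word_eq_foldr: "AR_word x p z = foldr AR_subst (map x [0..<p]) [z]"
proof (induction p arbitrary: x)
  case (Suc p)
  have "map x [0..<Suc p] = x 0 # map (\<lambda>i. x (Suc i)) [0..<p]"
    by (simp only: map_upt_Suc)
  then show ?case
    by (simp only: AR_word_Suc_eq_subst Suc.IH foldr.simps comp_apply)
qed simp

lemma foldr_AR_subst_nonempty: "foldr AR_subst D [z] \<noteq> []"
  by (induction D) auto

lemma set_foldr_AR_subst: "set (foldr AR_subst D [z]) = set (D @ [z])"
  by (induction D) (simp_all add: set_AR_subst foldr_AR_subst_nonempty)

lemma letters_eq_UNIV: "{La, Lb, Lc} = UNIV"
  using letter.exhaust by auto

lemma avoids_from_Nil: "avoids_from m []"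
  by (simp add: avoids_from_def)

text \<open>Prepending \<open>d\<close> creates a new occurrence of a pattern only if it begins with \<open>d = m\<close>; this is
  exactly the case excluded in \<open>letter_monotone_symmetric\<close>.\<close>

lemma avoids_from_Cons:
  assumes "{u, m, u'} = (UNIV :: letter set)"
  shows "avoids_from m (d # v) \<longleftrightarrow> avoids_from m v \<and> \<not> (d = m \<and> u \<in> set v \<and> u' \<in> set v)"
proof -
  have distinct: "u \<noteq> m" "m \<noteq> u'" "u \<noteq> u'"
    using assms unfolding letters_eq_UNIV[symmetric] by (cases u; cases m; cases u'; auto)+
  have avoids_iff: "avoids_from m v \<longleftrightarrow> \<not> subseq [m, u, u'] v \<and> \<not> subseq [m, u', u] v" for v
  proof -
    have "{m, p, q} = {La, Lb, Lc} \<longleftrightarrow> p = u \<and> q = u' \<or> p = u' \<and> q = u" for p q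
      using distinct by (cases u; cases m; cases u'; cases p; cases q; auto)
    then show ?thesis
      unfolding avoids_from_def by auto
  qed
  have pair: "subseq [p, q] v \<or> subseq [q, p] v \<longleftrightarrow> p \<in> set v \<and> q \<in> set v" if "p \<noteq> q" for p q :: letter and v
    using that by (induction v) (auto simp: subseq_Cons2_iff subseq_singleton_left split: if_splits)
  have "\<not> subseq (m # w) v" if "\<not> subseq w v" for w
    using that by (meson subseq_Cons')
  then show ?thesis
    using pair[OF distinct(3), of v] unfolding avoids_iff by (auto simp: subseq_Cons2_iff)
qed

text \<open>For the symmetric permutation the least letter has the greatest value of \<open>k\<close> and conversely, so
  for \<open>d\<close> at one end of the order the only inequality required compares with an extremal value.  For
  \<open>d = m\<close> the inequalities hold if one of the two sides is missing from \<open>S\<close>.\<close>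

lemma letter_monotone_symmetric:
  assumes "alphabet_order [u, m, u']"
  shows "letter_monotone (rank [u, m, u']) (\<lambda>l. 2 - rank [u, m, u'] l) d S \<longleftrightarrow>
    \<not> (d = m \<and> u \<in> S \<and> u' \<in> S)"
proof -
  have r: "rank [u, m, u'] u = 0" "rank [u, m, u'] m = 1" "rank [u, m, u'] u' = 2"
    using assms by (auto simp: rank_def alphabet_order_def)
  have letters: "l = u \<or> l = m \<or> l = u'" for l
    using assms by (auto simp: alphabet_order_def)
  have distinct: "u \<noteq> m" "m \<noteq> u'" "u \<noteq> u'"
    using assms by (auto simp: alphabet_order_def)
  consider "d = u" | "d = m" | "d = u'"
    using letters by blast
  then show ?thesis
  proof cases
    case 2
    have "(rank [u, m, u'] y < 1 \<longleftrightarrow> y = u) \<and> (1 < rank [u, m, u'] y \<longleftrightarrow> y = u') \<and>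
        (1 \<le> 2 - rank [u, m, u'] y \<longleftrightarrow> y \<noteq> u') \<and> (2 - rank [u, m, u'] y \<le> 1 \<longleftrightarrow> y \<noteq> u)" for y
      using letters[of y] distinct r by auto
    then show ?thesis
      unfolding letter_monotone_def 2 r by auto
  next
    case 3
    have "\<not> 2 < rank [u, m, u'] y" for y
      using letters[of y] r by auto
    then show ?thesis
      unfolding letter_monotone_def 3 r using distinct by simp
  qed (use distinct in \<open>auto simp: letter_monotone_def r\<close>)
qed

text \<open>If \<open>S\<close> has a letter on each side of \<open>m\<close>, then the value of \<open>m\<close> has to be both a lower and an
  upper bound for the value of \<open>u\<close>.  This excludes every permutation, not only the symmetric one.\<close>

lemma not_letter_monotone_middle:
  assumes "inj k" "r u < r m" "r m < r u'" "u \<in> S" "u' \<in> S"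
  shows "\<not> letter_monotone r k m S"
proof
  assume "letter_monotone r k m S"
  then have "k m \<le> k u" "k u \<le> k m"
    using assms unfolding letter_monotone_def by blast+
  then show False
    using assms(1,2) by (auto dest: injD)
qed

lemma last_monotone_singleton: "last_monotone r k [z]"
  by (simp add: last_monotone_def conjugates_def)

lemma last_monotone_symmetric_if_avoids:
  assumes "alphabet_order [u, m, u']" "avoids_from m (D @ [z])"
  shows "last_monotone (rank [u, m, u']) (\<lambda>l. 2 - rank [u, m, u'] l) (foldr AR_subst D [z])"
  using assms(2)
proof (induction D)
  case (Cons d D)
  have "{u, m, u'} = UNIV"
    using assms(1) by (simp add: alphabet_order_def)
  from avoids_from_Cons[OF this, of d "D @ [z]"] Cons show ?case
    using letter_monotone_symmetric[OF assms(1), of d "set (D @ [z])"]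
    by (simp add: last_monotone_subst[OF inj_rank[OF assms(1)] foldr_AR_subst_nonempty] set_foldr_AR_subst)
qed (simp add: last_monotone_singleton)

lemma avoids_if_last_monotone:
  assumes "alphabet_order [u, m, u']" "inj k"
    and "last_monotone (rank [u, m, u']) k (foldr AR_subst D [z])"
  shows "avoids_from m (D @ [z])"
proof -
  have UNIV_eq: "{u, m, u'} = UNIV"
    using assms(1) by (simp add: alphabet_order_def)
  have ranks: "rank [u, m, u'] u < rank [u, m, u'] m" "rank [u, m, u'] m < rank [u, m, u'] u'"
    using assms(1) by (auto simp: rank_def alphabet_order_def)
  show ?thesis
    using assms(3)
  proof (induction D)
    case Nil
    show ?case
      using avoids_from_Cons[OF UNIV_eq, of z "[]"] by (simp add: avoids_from_Nil)
  next
    case (Cons d D)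
    then have "last_monotone (rank [u, m, u']) k (foldr AR_subst D [z])"
      and "letter_monotone (rank [u, m, u']) k d (set (D @ [z]))"
      by (simp_all add: last_monotone_subst[OF inj_rank[OF assms(1)] foldr_AR_subst_nonempty] set_foldr_AR_subst)
    then show ?case
      using Cons.IH not_letter_monotone_middle[OF assms(2) ranks, of "set (D @ [z])"]
        avoids_from_Cons[OF UNIV_eq, of d "D @ [z]"] by auto
  qed
qed

lemma alphabet_order_three:
  fixes ord :: "letter list"
  assumes "alphabet_order ord"
  obtains u m u' where "ord = [u, m, u']"
proof -
  have "length ord = card (UNIV :: letter set)"
    using assms by (metis alphabet_order_def distinct_card)
  also have "\<dots> = 3"
    by (simp add: letters_eq_UNIV[symmetric])
  finally show ?thesis
    using that by (auto simp: numeral_3_eq_3 length_Suc_conv)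
qed

lemma clusters_perfectly_if_avoids:
  assumes "alphabet_order ord" "avoids_from (ord ! 1) (D @ [z])"
  shows "clusters_perfectly ord (foldr AR_subst D [z])"
proof -
  obtain u m u' where ord: "ord = [u, m, u']"
    using alphabet_order_three[OF assms(1)] .
  define \<pi> where "\<pi> = id(u := u', u' := u)"
  have distinct: "u \<noteq> m" "m \<noteq> u'" "u \<noteq> u'"
    using assms(1) by (auto simp: ord alphabet_order_def)
  have involution: "\<pi> (\<pi> l) = l" for l
    by (simp add: \<pi>_def)
  then have "bij \<pi>" "inv \<pi> = \<pi>"
    by (metis involuntory_imp_bij) (metis involution ext inv_equality)
  have reversal: "map \<pi> ord = rev ord"
    using distinct by (simp add: ord \<pi>_def)
  have "l = u \<or> l = m \<or> l = u'" for l
    using assms(1) by (auto simp: ord alphabet_order_def)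
  then have "(rank ord \<circ> inv \<pi>) l = 2 - rank ord l" for l
    using distinct unfolding \<open>inv \<pi> = \<pi>\<close> ord by (auto simp: \<pi>_def rank_def)
  then have "rank ord \<circ> inv \<pi> = (\<lambda>l. 2 - rank ord l)"
    by blast
  then have "last_monotone (rank ord) (rank ord \<circ> inv \<pi>) (foldr AR_subst D [z])"
    using last_monotone_symmetric_if_avoids[of u m u' D z] assms by (simp add: ord)
  moreover have "\<pi> \<noteq> id"
    using distinct by (metis \<pi>_def fun_upd_same id_apply)
  ultimately show ?thesis
    unfolding clusters_perfectly_def clusters_for_iff_last_monotone[OF assms(1)]
    using \<open>bij \<pi>\<close> reversal by blast
qed

lemma avoids_if_clusters_for:
  assumes "alphabet_order ord" "clusters_for ord \<pi> (foldr AR_subst D [z])"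
  shows "avoids_from (ord ! 1) (D @ [z])"
proof -
  obtain u m u' where ord: "ord = [u, m, u']"
    using alphabet_order_three[OF assms(1)] .
  have "bij \<pi>" and *: "last_monotone (rank ord) (rank ord \<circ> inv \<pi>) (foldr AR_subst D [z])"
    using assms clusters_for_iff_last_monotone by blast+
  have "inj (rank ord \<circ> inv \<pi>)"
    by (intro inj_compose inj_rank assms(1) bij_is_inj bij_imp_bij_inv \<open>bij \<pi>\<close>)
  then show ?thesis
    using avoids_if_last_monotone assms(1) * unfolding ord by fastforce
qed

lemma ex_order_with_middle: "\<exists>ord. alphabet_order ord \<and> ord ! 1 = (m :: letter)"
proof -
  have "alphabet_order [Lb, La, Lc]" "alphabet_order [La, Lb, Lc]" "alphabet_order [La, Lc, Lb]"
    unfolding alphabet_order_def letters_eq_UNIV[symmetric] by auto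
  then show ?thesis
    by (cases m) (metis nth_Cons_0 nth_Cons_Suc One_nat_def)+
qed

theorem corollary13:
  fixes \<Lambda> :: "letter list set" and x :: "nat \<Rightarrow> letter" and p :: nat and z :: letter
  assumes "AR_language \<Lambda> x"
  shows "(clusters (AR_word x p z) \<longleftrightarrow> (\<exists>z'. avoids_from z' (map x [0..<p] @ [z]))) \<and>
    (clusters (AR_word x p z) \<longrightarrow>
      (\<forall>ord. alphabet_order ord \<longrightarrow>
        (avoids_from (ord ! 1) (map x [0..<p] @ [z]) \<longrightarrow> clusters_perfectly ord (AR_word x p z)) \<and>
        (\<not> avoids_from (ord ! 1) (map x [0..<p] @ [z]) \<longrightarrow>
          (\<forall>\<pi>. \<not> clusters_for ord \<pi> (AR_word x p z)))))"
  using clusters_perfectly_if_avoids avoids_if_clusters_for ex_order_with_middle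
  unfolding AR_word_eq_foldr clusters_def clusters_perfectly_def by metis

end
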